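(* Let $(n_m)_{m\ge0}$ be a fixed sequence of non-negative integers and, for each prime $q$, let $(\mathbb{F}_q^{n_m},A_m)$ be a uniform random chain complex over $\mathbb{F}_q$ with $m$-th Betti number $\beta_m$. For $m\ge 0$ set \[ B_m=\bigl(-n_{m+1}+(n_m-(n_{m-1}-(\cdots-(n_1-n_0)_+\cdots)_+)_+)_+\bigr)_+ . \] Then for every $m\ge0$, \[ \mathbb{P}[\beta_m=B_m]\to 1\quad\text{as } q\to\infty \text{ (through primes)}. \]
   Context: Uniform random chain complex: given a prime $q$ and non-negative integers $(n_m)_{m\ge0}$, it is a random sequence of matrices $A_m$ over $\mathbb{F}_q$ ($m\ge 0$), where $A_m$ has size $n_{m-1}\times n_m$ for $m\geq 1$ and is regarded as a linear map $\mathbb{F}_q^{n_m}\to\mathbb{F}_q^{n_{m-1}}$, and $A_0:\mathbb{F}_q^{n_0}\to 0$ is the zero map. The matrices are chosen successively: for each $m\ge0$, given $A_0,\dots,A_m$, the matrix $A_{m+1}$ is uniformly distributed over all $n_m\times n_{m+1}$ matrices over $\mathbb{F}_q$ satisfying $A_mA_{m+1}=0$ (i.e. entries i.i.d. uniform on $\mathbb{F}_q$, conditioned on $A_mA_{m+1}=0$). Betti number: $\beta_m=\operatorname{nul}(A_m)-\operatorname{rank}(A_{m+1})=\dim_{\mathbb{F}_q}(\ker A_m/\operatorname{im}A_{m+1})$, where $\operatorname{nul}$ denotes the dimension of the kernel. Notation: $(n)_+=\max(0,n)$. The nested expression $B_m$ means: put $i_0^\ast=n_0$ and $i_\ell^\ast=(n_\ell-i_{\ell-1}^\ast)_+$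 for $\ell\ge1$; then $B_m=(-n_{m+1}+i_m^\ast)_+$. *)

theory Defs
  imports
    "HOL-Probability.Probability"
    "HOL-Number_Theory.Residues"
    "Jordan_Normal_Form.Matrix"
    "Jordan_Normal_Form.Missing_VectorSpace"
begin

section \<open>Matrices over a field given as a ring record\<close>

text \<open>
  The field varies inside the limit over primes, so it cannot be a type: it is a ring record \<open>F\<close>,
  to be instantiated with \<^term>\<open>residue_ring (int q)\<close>. The types of vectors and matrices serve only
  as containers that record dimensions; all arithmetic is that of \<open>F\<close>.
\<close>

definition coord_space :: "('a, 'b) ring_scheme \<Rightarrow> nat \<Rightarrow> ('a, 'a vec) module" where
  "coord_space F n =
    \<lparr>carrier = {v \<in> carrier_vec n. \<forall>i<n. v $ i \<in> carrier F},
     mult = undefined,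
     one = undefined,
     zero = vec n (\<lambda>_. \<zero>\<^bsub>F\<^esub>),
     add = (\<lambda>u v. vec n (\<lambda>i. u $ i \<oplus>\<^bsub>F\<^esub> v $ i)),
     smult = (\<lambda>c v. vec n (\<lambda>i. c \<otimes>\<^bsub>F\<^esub> v $ i))\<rparr>"

definition mats :: "('a, 'b) ring_scheme \<Rightarrow> nat \<Rightarrow> nat \<Rightarrow> 'a mat set" where
  "mats F r c = {A \<in> carrier_mat r c. \<forall>i<r. \<forall>j<c. A $$ (i, j) \<in> carrier F}"

definition zero_matrix :: "('a, 'b) ring_scheme \<Rightarrow> nat \<Rightarrow> nat \<Rightarrow> 'a mat" where
  "zero_matrix F r c = mat r c (\<lambda>_. \<zero>\<^bsub>F\<^esub>)"

definition matrix_mult :: "('a, 'b) ring_scheme \<Rightarrow> 'a mat \<Rightarrow> 'a mat \<Rightarrow> 'a mat" where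
  "matrix_mult F A B = mat (dim_row A) (dim_col B)
     (\<lambda>(i, j). \<Oplus>\<^bsub>F\<^esub>k\<in>{..<dim_col A}. A $$ (i, k) \<otimes>\<^bsub>F\<^esub> B $$ (k, j))"

definition matrix_map :: "('a, 'b) ring_scheme \<Rightarrow> 'a mat \<Rightarrow> 'a vec \<Rightarrow> 'a vec" where
  "matrix_map F A v = vec (dim_row A)
     (\<lambda>i. \<Oplus>\<^bsub>F\<^esub>k\<in>{..<dim_col A}. A $$ (i, k) \<otimes>\<^bsub>F\<^esub> v $ k)"

definition matrix_ker :: "('a, 'b) ring_scheme \<Rightarrow> 'a mat \<Rightarrow> 'a vec set" where
  "matrix_ker F A = {v \<in> carrier (coord_space F (dim_col A)).
     matrix_map F A v = \<zero>\<^bsub>coord_space F (dim_row A)\<^esub>}"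

definition matrix_im :: "('a, 'b) ring_scheme \<Rightarrow> 'a mat \<Rightarrow> 'a vec set" where
  "matrix_im F A = matrix_map F A ` carrier (coord_space F (dim_col A))"

definition nul :: "('a, 'b) ring_scheme \<Rightarrow> 'a mat \<Rightarrow> nat" where
  "nul F A = vectorspace.dim F (coord_space F (dim_col A)\<lparr>carrier := matrix_ker F A\<rparr>)"

definition matrix_rank :: "('a, 'b) ring_scheme \<Rightarrow> 'a mat \<Rightarrow> nat" where
  "matrix_rank F A = vectorspace.dim F (coord_space F (dim_row A)\<lparr>carrier := matrix_im F A\<rparr>)"

text \<open>
  The dimension of a subspace is meaningful only if the ambient structures are vector spaces and the
  matrix acts linearly; both are checked here, which makes the rank-nullity theorem available.
\<close>

lemma coord_space_simps:
  "carrier (coord_space F n) = {v \<in> carrier_vec n. \<forall>i<n. v $ i \<in> carrier F}"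
  "\<zero>\<^bsub>coord_space F n\<^esub> = vec n (\<lambda>_. \<zero>\<^bsub>F\<^esub>)"
  "u \<oplus>\<^bsub>coord_space F n\<^esub> v = vec n (\<lambda>i. u $ i \<oplus>\<^bsub>F\<^esub> v $ i)"
  "c \<odot>\<^bsub>coord_space F n\<^esub> v = vec n (\<lambda>i. c \<otimes>\<^bsub>F\<^esub> v $ i)"
  by (simp_all add: coord_space_def)

lemma vectorspace_coord_space:
  assumes "field F"
  shows "vectorspace F (coord_space F n)"
proof -
  interpret field F by fact
  have "abelian_group (coord_space F n)"
  proof (rule abelian_groupI)
    fix x assume x: "x \<in> carrier (coord_space F n)"
    show "\<exists>y\<in>carrier (coord_space F n). y \<oplus>\<^bsub>coord_space F n\<^esub> x = \<zero>\<^bsub>coord_space F n\<^esub>"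
      using x by (intro bexI[of _ "vec n (\<lambda>i. \<ominus>\<^bsub>F\<^esub> x $ i)"])
        (auto simp: coord_space_simps l_neg)
  qed (auto simp: coord_space_simps a_ac)
  then have "module F (coord_space F n)"
    by (intro moduleI) (auto simp: coord_space_simps is_cring l_distr r_distr m_assoc)
  then show ?thesis
    by (simp add: vectorspace_def field_axioms)
qed

lemma linear_map_matrix_map:
  assumes "field F" "A \<in> mats F r c"
  shows "linear_map F (coord_space F c) (coord_space F r) (matrix_map F A)"
proof -
  interpret field F by fact
  interpret V: vectorspace F "coord_space F c" by (rule vectorspace_coord_space) fact
  interpret W: vectorspace F "coord_space F r" by (rule vectorspace_coord_space) fact
  have [simp]: "dim_row A = r" "dim_col A = c"
    "\<And>i j. i < r \<Longrightarrow> j < c \<Longrightarrow> A $$ (i, j) \<in> carrier F"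
    using assms(2) by (auto simp: mats_def)
  have cl: "matrix_map F A v \<in> carrier (coord_space F r)"
    if "v \<in> carrier (coord_space F c)" for v
    using that by (auto simp: matrix_map_def coord_space_simps intro!: finsum_closed)
  have add: "matrix_map F A (u \<oplus>\<^bsub>coord_space F c\<^esub> v) =
      matrix_map F A u \<oplus>\<^bsub>coord_space F r\<^esub> matrix_map F A v"
    if "u \<in> carrier (coord_space F c)" "v \<in> carrier (coord_space F c)" for u v
  proof (rule eq_vecI)
    fix i assume "i < dim_vec (matrix_map F A u \<oplus>\<^bsub>coord_space F r\<^esub> matrix_map F A v)"
    then have i: "i < r" by (simp add: coord_space_simps)
    have "(\<Oplus>\<^bsub>F\<^esub>k\<in>{..<c}. A $$ (i, k) \<otimes>\<^bsub>F\<^esub> (vec c (\<lambda>i. u $ i \<oplus>\<^bsub>F\<^esub> v $ i)) $ k) =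
        (\<Oplus>\<^bsub>F\<^esub>k\<in>{..<c}. A $$ (i, k) \<otimes>\<^bsub>F\<^esub> u $ k \<oplus>\<^bsub>F\<^esub> A $$ (i, k) \<otimes>\<^bsub>F\<^esub> v $ k)"
      using i that by (intro finsum_cong') (auto simp: coord_space_simps r_distr)
    also have "\<dots> = (\<Oplus>\<^bsub>F\<^esub>k\<in>{..<c}. A $$ (i, k) \<otimes>\<^bsub>F\<^esub> u $ k) \<oplus>\<^bsub>F\<^esub>
        (\<Oplus>\<^bsub>F\<^esub>k\<in>{..<c}. A $$ (i, k) \<otimes>\<^bsub>F\<^esub> v $ k)"
      using i that by (intro finsum_addf) (auto simp: coord_space_simps)
    finally show "matrix_map F A (u \<oplus>\<^bsub>coord_space F c\<^esub> v) $ i =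
        (matrix_map F A u \<oplus>\<^bsub>coord_space F r\<^esub> matrix_map F A v) $ i"
      using i by (simp add: matrix_map_def coord_space_simps)
  qed (simp add: matrix_map_def coord_space_simps)
  have smult: "matrix_map F A (a \<odot>\<^bsub>coord_space F c\<^esub> v) =
      a \<odot>\<^bsub>coord_space F r\<^esub> matrix_map F A v"
    if "a \<in> carrier F" "v \<in> carrier (coord_space F c)" for a v
  proof (rule eq_vecI)
    fix i assume "i < dim_vec (a \<odot>\<^bsub>coord_space F r\<^esub> matrix_map F A v)"
    then have i: "i < r" by (simp add: coord_space_simps)
    have "(\<Oplus>\<^bsub>F\<^esub>k\<in>{..<c}. A $$ (i, k) \<otimes>\<^bsub>F\<^esub> (vec c (\<lambda>i. a \<otimes>\<^bsub>F\<^esub> v $ i)) $ k) =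
        (\<Oplus>\<^bsub>F\<^esub>k\<in>{..<c}. a \<otimes>\<^bsub>F\<^esub> (A $$ (i, k) \<otimes>\<^bsub>F\<^esub> v $ k))"
      using i that by (intro finsum_cong') (auto simp: coord_space_simps m_lcomm)
    also have "\<dots> = a \<otimes>\<^bsub>F\<^esub> (\<Oplus>\<^bsub>F\<^esub>k\<in>{..<c}. A $$ (i, k) \<otimes>\<^bsub>F\<^esub> v $ k)"
      using i that by (intro finsum_rdistr[symmetric]) (auto simp: coord_space_simps)
    finally show "matrix_map F A (a \<odot>\<^bsub>coord_space F c\<^esub> v) $ i =
        (a \<odot>\<^bsub>coord_space F r\<^esub> matrix_map F A v) $ i"
      using i by (simp add: matrix_map_def coord_space_simps)
  qed (simp add: matrix_map_def coord_space_simps)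
  show ?thesis
    by unfold_locales (use cl add smult in \<open>auto simp: module_hom_def\<close>)
qed

section \<open>Uniform random chain complexes\<close>

text \<open>
  The index is that of the domain: the \<open>m\<close>-th matrix maps into the space of dimension
  \<open>target_dim n m\<close>, and the target of the \<open>0\<close>-th matrix is the zero space.
\<close>

definition target_dim :: "(nat \<Rightarrow> nat) \<Rightarrow> nat \<Rightarrow> nat" where
  "target_dim n m = (case m of 0 \<Rightarrow> 0 | Suc k \<Rightarrow> n k)"

definition admissible_next ::
    "('a, 'b) ring_scheme \<Rightarrow> (nat \<Rightarrow> nat) \<Rightarrow> nat \<Rightarrow> 'a mat \<Rightarrow> 'a mat set" where
  "admissible_next F n m A = {C \<in> mats F (n m) (n (Suc m)).
     matrix_mult F A C = zero_matrix F (target_dim n m) (n (Suc m))}"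

text \<open>
  All matrix spaces in question are finite, so conditioning on the past means conditioning on each
  past \<open>a 0, \<dots>, a m\<close> that occurs with positive probability.
\<close>

locale uniform_random_chain_complex = prob_space M
  for M :: "'w measure" +
  fixes F :: "('a, 'b) ring_scheme"
    and n :: "nat \<Rightarrow> nat"
    and A :: "nat \<Rightarrow> 'w \<Rightarrow> 'a mat"
  assumes random_matrix: "A m \<in> measurable M (count_space (mats F (target_dim n m) (n m)))"
    and uniform_next:
      "\<P>(\<omega> in M. \<forall>i\<le>m. A i \<omega> = a i) > 0 \<Longrightarrow> C \<in> admissible_next F n m (a m) \<Longrightarrow>
       \<P>(\<omega> in M. A (Suc m) \<omega> = C \<bar> \<forall>i\<le>m. A i \<omega> = a i) =
         1 / real (card (admissible_next F n m (a m)))"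

definition betti :: "('a, 'b) ring_scheme \<Rightarrow> (nat \<Rightarrow> 'a mat) \<Rightarrow> nat \<Rightarrow> int" where
  "betti F A m = int (nul F (A m)) - int (matrix_rank F (A (Suc m)))"

fun nested_diff :: "(nat \<Rightarrow> nat) \<Rightarrow> nat \<Rightarrow> int" where
  "nested_diff n 0 = int (n 0)"
| "nested_diff n (Suc l) = max 0 (int (n (Suc l)) - nested_diff n l)"

definition expected_betti :: "(nat \<Rightarrow> nat) \<Rightarrow> nat \<Rightarrow> int" where
  "expected_betti n m = max 0 (- int (n (Suc m)) + nested_diff n m)"

end

theory Submission
  imports Defs
begin

text \<open>
  Given \<open>A\<^sub>m\<close> with kernel \<open>W\<close> of dimension \<open>k\<close>, the columns of \<open>A\<^sub>m\<^sub>+\<^sub>1\<close> are \<open>c\<close> independent uniform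
  vectors of \<open>W\<close>. If the rank is below \<open>min k c\<close>, then for some \<open>i < min k c\<close> the \<open>i\<close>-th column is
  a combination of the preceding ones; for each of the at most \<open>q\<^sup>i\<close> coefficient vectors this has
  probability \<open>q\<^sup>-\<^sup>k\<close>. The union bound gives \<open>rank A\<^sub>m\<^sub>+\<^sub>1 = min k c\<close> with probability at least
  \<open>1 - c/q\<close>, whatever the history, and if this holds at all steps up to \<open>m\<close>, then the nullities
  follow the recursion of the nested differences. Dimensions are handled through
  cardinalities: a space of dimension \<open>d\<close> has \<open>q\<^sup>d\<close> elements.
\<close>

text \<open>Without this, \<open>v $ i\<close> is ambiguous between the vectors of \<open>HOL-Analysis\<close> and of \<open>Jordan_Normal_Form\<close>.\<close>
no_notation Finite_Cartesian_Product.vec_nth (infixl "$" 90)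

section \<open>Counting in vector spaces over a finite field\<close>

text \<open>Coordinates with respect to a finite basis identify the space with the functions from
  that basis to the scalars. Through this formula, inequalities between dimensions become
  inequalities between cardinalities.\<close>

lemma (in vectorspace) card_carrier_eq:
  assumes "finite (carrier K)" "finite (carrier V)"
  shows "card (carrier V) = card (carrier K) ^ dim"
proof -
  \<comment> \<open>The finite carrier is itself a spanning set, which supplies
    \<open>fin_dim\<close> and hence a finite basis.\<close>
  have "span (carrier V) = carrier V"
    using in_own_span[of "carrier V"] span_is_subset2[of "carrier V"] by auto
  then have "fin_dim"
    using assms(2) by (auto simp: fin_dim_def)
  then obtain B where B: "finite B" "basis B"
    using finite_basis_exists by blast
  then have B': "B \<subseteq> carrier V"
    by (auto simp: basis_def)
  have ex1: "\<exists>!a. a \<in> B \<rightarrow>\<^sub>E carrier K \<and> lincomb a B = v" if "v \<in> carrier V" for v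
    using basis_criterion[OF B(1) B'] B(2) that by simp
  have lc: "lincomb a B \<in> carrier V" if "a \<in> B \<rightarrow>\<^sub>E carrier K" for a
    using that B' by (intro lincomb_closed) (auto simp: PiE_def)
  have "bij_betw (\<lambda>a. lincomb a B) (B \<rightarrow>\<^sub>E carrier K) (carrier V)"
    unfolding bij_betw_def
  proof (intro conjI inj_onI equalityI subsetI)
    fix a b assume "a \<in> B \<rightarrow>\<^sub>E carrier K" "b \<in> B \<rightarrow>\<^sub>E carrier K" "lincomb a B = lincomb b B"
    then show "a = b" using ex1 lc by metis
  next
    fix v assume "v \<in> carrier V"
    then show "v \<in> (\<lambda>a. lincomb a B) ` (B \<rightarrow>\<^sub>E carrier K)" using ex1 by blast
  qed (use lc in blast)
  then have "card (carrier V) = card (B \<rightarrow>\<^sub>E carrier K)"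
    by (simp add: bij_betw_same_card)
  also have "\<dots> = card (carrier K) ^ dim"
    using B by (simp add: card_PiE dim_basis)
  finally show ?thesis .
qed

section \<open>Cardinalities of coordinate spaces and matrix sets\<close>

text \<open>\<open>vec n\<close> ignores values at arguments from \<open>n\<close> on; taking
  extensional functions fixes those values and makes it injective.\<close>

lemma bij_betw_coord_space:
  "bij_betw (vec n) ({..<n} \<rightarrow>\<^sub>E carrier F) (carrier (coord_space F n))"
proof (rule bij_betw_byWitness[where f' = "\<lambda>v. restrict (\<lambda>i. v $ i) {..<n}"])
  show "\<forall>f\<in>{..<n} \<rightarrow>\<^sub>E carrier F. restrict (\<lambda>i. vec n f $ i) {..<n} = f"
  proof
    fix f assume f: "f \<in> {..<n} \<rightarrow>\<^sub>E carrier F"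
    show "restrict (\<lambda>i. vec n f $ i) {..<n} = f"
      by (rule extensionalityI[of _ "{..<n}"]) (use f in \<open>auto simp: PiE_def\<close>)
  qed
  show "\<forall>v\<in>carrier (coord_space F n). vec n (restrict (\<lambda>i. v $ i) {..<n}) = v"
    by (auto simp: coord_space_simps)
  show "vec n ` ({..<n} \<rightarrow>\<^sub>E carrier F) \<subseteq> carrier (coord_space F n)"
    by (auto simp: coord_space_simps PiE_def)
  show "(\<lambda>v. restrict (\<lambda>i. v $ i) {..<n}) ` carrier (coord_space F n) \<subseteq> {..<n} \<rightarrow>\<^sub>E carrier F"
    by (auto simp: coord_space_simps split: if_splits)
qed

lemma finite_coord_space: "finite (carrier F) \<Longrightarrow> finite (carrier (coord_space F n))"
  using bij_betw_finite[OF bij_betw_coord_space[of n F]] by (simp add: finite_PiE)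

lemma card_coord_space: "card (carrier (coord_space F n)) = card (carrier F) ^ n"
  using bij_betw_same_card[OF bij_betw_coord_space[of n F]] by (simp add: card_PiE)

lemma finite_mats:
  assumes "finite (carrier F)"
  shows "finite (mats F r c)"
proof -
  have "mats F r c \<subseteq> (\<lambda>f. mat r c f) ` (({..<r} \<times> {..<c}) \<rightarrow>\<^sub>E carrier F)"
  proof
    fix A assume A: "A \<in> mats F r c"
    then have "A = mat r c (restrict (($$) A) ({..<r} \<times> {..<c}))"
      by (intro eq_matI) (auto simp: mats_def)
    then show "A \<in> (\<lambda>f. mat r c f) ` (({..<r} \<times> {..<c}) \<rightarrow>\<^sub>E carrier F)"
      using A by (intro image_eqI[of _ _ "restrict (($$) A) ({..<r} \<times> {..<c})"]) (auto simp: mats_def)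
  qed
  then show ?thesis
    by (rule finite_subset) (simp add: assms finite_PiE)
qed

text \<open>For \<open>W\<close> the kernel of the current matrix this is the set of admissible next
  matrices, see \<open>admissible_next_eq\<close>. The counting below works with a general
  \<open>W\<close>.\<close>

definition mats_with_cols_in :: "'a vec set \<Rightarrow> nat \<Rightarrow> nat \<Rightarrow> 'a mat set" where
  "mats_with_cols_in W r c = {C \<in> carrier_mat r c. \<forall>j<c. col C j \<in> W}"

lemma mats_with_cols_in_subset_mats:
  assumes "W \<subseteq> carrier (coord_space F r)"
  shows "mats_with_cols_in W r c \<subseteq> mats F r c"
proof
  fix C assume C: "C \<in> mats_with_cols_in W r c"
  have "C $$ (i, j) \<in> carrier F" if "i < r" "j < c" for i j
  proof -
    have "col C j \<in> carrier (coord_space F r)"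
      using C assms that by (auto simp: mats_with_cols_in_def)
    then have "col C j $ i \<in> carrier F"
      using that by (simp add: coord_space_simps)
    then show ?thesis
      using C that by (auto simp: mats_with_cols_in_def)
  qed
  then show "C \<in> mats F r c"
    using C by (simp add: mats_with_cols_in_def mats_def)
qed

text \<open>Columns can be chosen freely in \<open>W\<close>, and the assembled matrix returns them.
  This lower bound controls the denominator of the uniform distribution.\<close>

lemma card_mats_with_cols_in_ge:
  assumes "finite (carrier F)" "W \<subseteq> carrier (coord_space F r)"
  shows "card W ^ c \<le> card (mats_with_cols_in W r c)"
proof -
  have W: "w \<in> carrier_vec r" if "w \<in> W" for w
    using assms(2) that by (auto simp: coord_space_simps)
  have "card ({..<c} \<rightarrow>\<^sub>E W) \<le> card (mats_with_cols_in W r c)"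
  proof (rule card_inj_on_le)
    show "inj_on (\<lambda>f. mat_of_cols r (map f [0..<c])) ({..<c} \<rightarrow>\<^sub>E W)"
    proof (rule inj_onI)
      fix f g assume fg: "f \<in> {..<c} \<rightarrow>\<^sub>E W" "g \<in> {..<c} \<rightarrow>\<^sub>E W"
        "mat_of_cols r (map f [0..<c]) = mat_of_cols r (map g [0..<c])"
      show "f = g"
      proof (rule PiE_ext[OF fg(1,2)])
        fix j assume j: "j \<in> {..<c}"
        have "col (mat_of_cols r (map f [0..<c])) j = f j" "col (mat_of_cols r (map g [0..<c])) j = g j"
          using j fg W by (subst col_mat_of_cols; auto)+
        then show "f j = g j" using fg(3) by simp
      qed
    qed
    show "(\<lambda>f. mat_of_cols r (map f [0..<c])) ` ({..<c} \<rightarrow>\<^sub>E W) \<subseteq> mats_with_cols_in W r c"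
    proof -
      have "col (mat_of_cols r (map f [0..<c])) j \<in> W" if "f \<in> {..<c} \<rightarrow>\<^sub>E W" "j < c" for f j
        using that W by (subst col_mat_of_cols) auto
      then show ?thesis
        by (auto simp: mats_with_cols_in_def)
    qed
    show "finite (mats_with_cols_in W r c)"
      using finite_subset[OF mats_with_cols_in_subset_mats[OF assms(2)] finite_mats[OF assms(1)]] .
  qed
  then show ?thesis by (simp add: card_PiE)
qed

section \<open>Rank and nullity over a finite field\<close>

locale finite_field = field F for F :: "('a, 'b) ring_scheme" (structure) +
  assumes finite_carrier: "finite (carrier F)"
begin

lemma card_carrier_gt_1: "1 < card (carrier F)"
proof -
  have "card {\<zero>, \<one>} \<le> card (carrier F)"
    using finite_carrier by (intro card_mono) auto
  then show ?thesis by simp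
qed

text \<open>The cardinality is a power of \<open>card (carrier F)\<close> in two ways, and powers of
  a base above 1 determine the exponent.\<close>

lemma dim_coord_space: "vectorspace.dim F (coord_space F n) = n"
proof -
  interpret V: vectorspace F "coord_space F n"
    by (rule vectorspace_coord_space) unfold_locales
  show ?thesis
    using V.card_carrier_eq finite_carrier finite_coord_space[OF finite_carrier] card_coord_space[of F n]
      card_carrier_gt_1 by (metis power_inject_exp)
qed

lemma fin_dim_coord_space: "vectorspace.fin_dim F (coord_space F n)"
proof -
  interpret V: vectorspace F "coord_space F n"
    by (rule vectorspace_coord_space) unfold_locales
  have "V.span (carrier (coord_space F n)) = carrier (coord_space F n)"
    using V.in_own_span[of "carrier (coord_space F n)"]
      V.span_is_subset2[of "carrier (coord_space F n)"] by auto
  then show ?thesis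
    using finite_coord_space[OF finite_carrier] by (auto simp: V.fin_dim_def)
qed

context
  fixes A r c
  assumes A: "A \<in> mats F r c"
begin

interpretation linear_map F "coord_space F c" "coord_space F r" "matrix_map F A"
  by (rule linear_map_matrix_map[OF _ A]) unfold_locales

lemma dims_mat [simp]: "dim_row A = r" "dim_col A = c"
  using A by (auto simp: mats_def)

lemma matrix_ker_eq: "matrix_ker F A = kerT"
  by (simp add: matrix_ker_def ker_def)

lemma matrix_im_eq: "matrix_im F A = imT"
  by (simp add: matrix_im_def im_def)

lemma matrix_ker_subset: "matrix_ker F A \<subseteq> carrier (coord_space F c)"
  by (auto simp: matrix_ker_eq ker_def)

lemma matrix_im_subset: "matrix_im F A \<subseteq> carrier (coord_space F r)"
  by (auto simp: matrix_im_eq im_def)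

lemma submodule_matrix_ker: "submodule F (matrix_ker F A) (coord_space F c)"
  unfolding matrix_ker_eq by (rule ker_is_submodule)

lemma card_matrix_ker: "card (matrix_ker F A) = card (carrier F) ^ nul F A"
proof -
  interpret ker: vectorspace F "coord_space F c\<lparr>carrier := matrix_ker F A\<rparr>"
    unfolding matrix_ker_eq by (rule V.subspace_is_vs[OF kerT_is_subspace])
  have "finite (matrix_ker F A)"
    by (rule finite_subset[OF matrix_ker_subset finite_coord_space[OF finite_carrier]])
  then show ?thesis
    using ker.card_carrier_eq finite_carrier by (simp add: nul_def)
qed

lemma card_matrix_im: "card (matrix_im F A) = card (carrier F) ^ matrix_rank F A"
proof -
  interpret im: vectorspace F "coord_space F r\<lparr>carrier := matrix_im F A\<rparr>"
    unfolding matrix_im_eq by (rule W.subspace_is_vs[OF imT_is_subspace])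
  have "finite (matrix_im F A)"
    by (rule finite_subset[OF matrix_im_subset finite_coord_space[OF finite_carrier]])
  then show ?thesis
    using im.card_carrier_eq finite_carrier by (simp add: matrix_rank_def)
qed

lemma matrix_rank_plus_nul: "matrix_rank F A + nul F A = c"
  using rank_nullity[OF fin_dim_coord_space]
  unfolding dim_coord_space nul_def matrix_rank_def dims_mat matrix_ker_eq matrix_im_eq .

lemma matrix_rank_le_target_dim: "matrix_rank F A \<le> r"
proof -
  have "card (matrix_im F A) \<le> card (carrier F) ^ r"
    using card_mono[OF finite_coord_space[OF finite_carrier] matrix_im_subset]
    by (simp add: card_coord_space)
  then show ?thesis
    using card_carrier_gt_1 by (simp add: card_matrix_im)
qed

text \<open>
  By pigeonhole two vectors supported on the first \<open>s\<close> coordinates have the same image; their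
  difference, scaled to have its last nonzero entry equal to \<open>\<one>\<close>, is the witness.
\<close>

lemma matrix_map_kernel_witness:
  assumes "s \<le> c" "matrix_rank F A < s"
  obtains i v where "i < s" "v \<in> carrier (coord_space F c)" "v $ i = \<one>"
    "\<And>j. i < j \<Longrightarrow> j < c \<Longrightarrow> v $ j = \<zero>" "v \<in> matrix_ker F A"
proof -
  define U where "U = (\<lambda>u. vec c (\<lambda>i. if i < s then u $ i else \<zero>)) ` carrier (coord_space F s)"
  have U: "U \<subseteq> carrier (coord_space F c)"
    by (auto simp: U_def coord_space_simps)
  have "inj_on (\<lambda>u. vec c (\<lambda>i. if i < s then u $ i else \<zero>)) (carrier (coord_space F s))"
  proof (rule inj_onI)
    fix u w assume uw: "u \<in> carrier (coord_space F s)" "w \<in> carrier (coord_space F s)"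
      "vec c (\<lambda>i. if i < s then u $ i else \<zero>) = vec c (\<lambda>i. if i < s then w $ i else \<zero>)"
    show "u = w"
    proof (rule eq_vecI)
      fix i assume "i < dim_vec w"
      then have "i < s" using uw by (auto simp: coord_space_simps)
      then show "u $ i = w $ i"
        using arg_cong[OF uw(3), of "\<lambda>v. v $ i"] assms(1) by simp
    qed (use uw in \<open>auto simp: coord_space_simps\<close>)
  qed
  then have "card U = card (carrier F) ^ s"
    by (simp add: U_def card_image card_coord_space)
  \<comment> \<open>\<open>U\<close> has as many elements as an \<open>s\<close>-dimensional space,
    while all images lie in a space of dimension below \<open>s\<close>.\<close>
  moreover have "card (matrix_map F A ` U) \<le> card (carrier F) ^ matrix_rank F A"
    unfolding card_matrix_im[symmetric] using U A
    by (intro card_mono finite_subset[OF matrix_im_subset finite_coord_space[OF finite_carrier]])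
      (auto simp: matrix_im_def mats_def)
  moreover have "card (carrier F) ^ matrix_rank F A < card (carrier F) ^ s"
    using assms(2) card_carrier_gt_1 by simp
  ultimately have "\<not> inj_on (matrix_map F A) U"
    by (intro pigeonhole) simp
  then obtain u w where uw: "u \<in> U" "w \<in> U" "u \<noteq> w" "matrix_map F A u = matrix_map F A w"
    by (auto simp: inj_on_def)
  define d where "d = u \<ominus>\<^bsub>coord_space F c\<^esub> w"
  have uw': "u \<in> carrier (coord_space F c)" "w \<in> carrier (coord_space F c)"
    using uw U by auto
  have d: "d \<in> carrier (coord_space F c)"
    using uw' by (simp add: d_def)
  \<comment> \<open>The rules for coordinate spaces describe addition entrywise, so the entries of
    the difference \<open>d\<close> are accessed through this sum.\<close>
  have "u = d \<oplus>\<^bsub>coord_space F c\<^esub> w"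
    using uw' by (simp add: d_def V.module.M.minus_eq V.module.M.add.m_assoc V.module.M.l_neg)
  then have u_eq: "u $ i = d $ i \<oplus> w $ i" if "i < c" for i
    using that by (simp add: coord_space_simps)
  have d0: "matrix_map F A d = \<zero>\<^bsub>coord_space F r\<^esub>"
    using uw uw' by (simp add: d_def f_minus W.module.M.minus_eq W.module.M.r_neg)
  have dc: "d $ i \<in> carrier F" "w $ i \<in> carrier F" if "i < c" for i
    using d uw' that by (auto simp: coord_space_simps)
  \<comment> \<open>Both vectors vanish from position \<open>s\<close> on, so the last nonzero entry
    of \<open>d\<close> sits below \<open>s\<close>.\<close>
  have ds: "d $ i = \<zero>" if "s \<le> i" "i < c" for i
  proof -
    have "u $ i = \<zero>" "w $ i = \<zero>"
      using uw(1,2) that by (auto simp: U_def)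
    then show ?thesis
      using u_eq[OF that(2)] dc(1)[OF that(2)] by simp
  qed
  have "\<exists>i<c. d $ i \<noteq> \<zero>"
  proof (rule ccontr)
    assume "\<not> ?thesis"
    then have "u = w"
      using u_eq dc uw' by (intro eq_vecI) (auto simp: coord_space_simps)
    with uw show False by simp
  qed
  then have ne: "{i. i < c \<and> d $ i \<noteq> \<zero>} \<noteq> {}" (is "?I \<noteq> _") by auto
  define i where "i = Max ?I"
  have i: "i \<in> ?I" unfolding i_def by (rule Max_in) (use ne in auto)
  have i_max: "d $ j = \<zero>" if "i < j" "j < c" for j
    using Max_ge[of ?I j] that by (force simp: i_def[symmetric])
  define a where "a = inv (d $ i)"
  have a: "a \<in> carrier F" "a \<otimes> d $ i = \<one>"
  proof -
    have "d $ i \<in> Units F"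
      using i dc(1)[of i] by (simp add: field_Units)
    then show "a \<in> carrier F" "a \<otimes> d $ i = \<one>"
      by (simp_all add: a_def)
  qed
  show ?thesis
  proof (rule that[of i "a \<odot>\<^bsub>coord_space F c\<^esub> d"])
    show "i < s" using i ds[of i] by (cases "i < s") auto
    show "a \<odot>\<^bsub>coord_space F c\<^esub> d \<in> carrier (coord_space F c)" using a d by simp
    show "(a \<odot>\<^bsub>coord_space F c\<^esub> d) $ i = \<one>" using i a by (simp add: coord_space_simps)
    show "(a \<odot>\<^bsub>coord_space F c\<^esub> d) $ j = \<zero>" if "i < j" "j < c" for j
      using that i_max a by (simp add: coord_space_simps)
    show "a \<odot>\<^bsub>coord_space F c\<^esub> d \<in> matrix_ker F A"
      using a d d0 by (simp add: matrix_ker_eq ker_def)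
  qed
qed

end

section \<open>Matrices with columns in a subspace\<close>

lemma matrix_map_col:
  assumes "A \<in> mats F r k" "C \<in> mats F k c" "j < c"
  shows "matrix_map F A (col C j) = col (matrix_mult F A C) j"
proof (rule eq_vecI)
  fix i assume "i < dim_vec (col (matrix_mult F A C) j)"
  then have i: "i < r"
    using assms by (auto simp: matrix_mult_def mats_def)
  show "matrix_map F A (col C j) $ i = col (matrix_mult F A C) j $ i"
    using i assms by (auto simp: matrix_mult_def matrix_map_def mats_def intro!: finsum_cong')
qed (use assms in \<open>auto simp: matrix_mult_def matrix_map_def mats_def\<close>)

text \<open>The product acts column by column, so the chain condition constrains each column
  separately; this is why the columns can be chosen independently.\<close>

lemma matrix_mult_eq_zero_iff:
  assumes A: "A \<in> mats F r k" and C: "C \<in> mats F k c"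
  shows "matrix_mult F A C = zero_matrix F r c \<longleftrightarrow> (\<forall>j<c. col C j \<in> matrix_ker F A)"
proof -
  have dims: "dim_row A = r" "dim_col A = k" "dim_row C = k" "dim_col C = c"
    using A C by (auto simp: mats_def)
  have "matrix_mult F A C = zero_matrix F r c \<longleftrightarrow>
      (\<forall>j<c. col (matrix_mult F A C) j = vec r (\<lambda>_. \<zero>))" (is "?l \<longleftrightarrow> ?r")
  proof
    assume ?l
    then show ?r by (auto simp: zero_matrix_def)
  next
    assume r: ?r
    show ?l
    proof (rule eq_matI)
      fix i j assume "i < dim_row (zero_matrix F r c)" "j < dim_col (zero_matrix F r c)"
      then have ij: "i < r" "j < c" by (auto simp: zero_matrix_def)
      have "matrix_mult F A C $$ (i, j) = col (matrix_mult F A C) j $ i"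
        using ij by (simp add: matrix_mult_def dims)
      also have "\<dots> = zero_matrix F r c $$ (i, j)"
        using r ij by (simp add: zero_matrix_def)
      finally show "matrix_mult F A C $$ (i, j) = zero_matrix F r c $$ (i, j)" .
    qed (auto simp: matrix_mult_def zero_matrix_def dims)
  qed
  also have "\<dots> \<longleftrightarrow> (\<forall>j<c. col C j \<in> matrix_ker F A)"
  proof -
    have "col C j \<in> carrier (coord_space F k)" if "j < c" for j
      using C that by (auto simp: coord_space_simps mats_def)
    then show ?thesis
      using matrix_map_col[OF A C] by (auto simp: matrix_ker_def dims coord_space_simps(2))
  qed
  finally show ?thesis .
qed

text \<open>The image of \<open>v\<close> is the linear combination of the columns of
  \<open>C\<close> with the entries of \<open>v\<close> as coefficients.\<close>

lemma matrix_map_in_submodule: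
  assumes W: "submodule F W (coord_space F r)"
    and C: "C \<in> mats_with_cols_in W r c" and v: "v \<in> carrier (coord_space F c)"
  shows "matrix_map F C v \<in> W"
proof -
  interpret W: submodule F W "coord_space F r" by fact
  have "C \<in> mats F r c"
    using mats_with_cols_in_subset_mats[OF W.subset] C by blast
  then have C': "dim_row C = r" "dim_col C = c"
    "\<And>i j. i < r \<Longrightarrow> j < c \<Longrightarrow> C $$ (i, j) \<in> carrier F"
    by (auto simp: mats_def)
  have v': "v $ k \<in> carrier F" if "k < c" for k
    using v that by (auto simp: coord_space_simps)
  \<comment> \<open>Induction over partial sums: each step adds one scalar multiple of a column, so
    closure of \<open>W\<close> under addition and scaling suffices.\<close>
  have "vec r (\<lambda>i. \<Oplus>k\<in>{..<t}. C $$ (i, k) \<otimes> v $ k) \<in> W" if "t \<le> c" for t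
    using that
  proof (induction t)
    case 0
    then show ?case
      using W.zero_closed by (simp add: coord_space_simps)
  next
    case (Suc t)
    have "vec r (\<lambda>i. \<Oplus>k\<in>{..<Suc t}. C $$ (i, k) \<otimes> v $ k) =
        v $ t \<odot>\<^bsub>coord_space F r\<^esub> col C t \<oplus>\<^bsub>coord_space F r\<^esub>
        vec r (\<lambda>i. \<Oplus>k\<in>{..<t}. C $$ (i, k) \<otimes> v $ k)"
    proof (rule eq_vecI, goal_cases)
      case (1 i)
      then have i: "i < r" by (simp add: coord_space_simps)
      have "(\<Oplus>k\<in>insert t {..<t}. C $$ (i, k) \<otimes> v $ k) =
          C $$ (i, t) \<otimes> v $ t \<oplus> (\<Oplus>k\<in>{..<t}. C $$ (i, k) \<otimes> v $ k)"
        using Suc.prems i C' v' by (intro finsum_insert) auto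
      then show ?case
        using Suc.prems i C' v' by (simp add: coord_space_simps lessThan_Suc m_comm)
    qed (simp add: coord_space_simps)
    moreover have "v $ t \<odot>\<^bsub>coord_space F r\<^esub> col C t \<in> W"
      using Suc.prems C v' by (intro W.smult_closed) (auto simp: mats_with_cols_in_def)
    ultimately show ?case
      using Suc by (simp add: W.m_closed)
  qed
  from this[of c] show ?thesis
    by (simp add: matrix_map_def C')
qed

section \<open>Counting matrices of deficient rank\<close>

text \<open>Since entry \<open>i\<close> of \<open>v\<close> is \<open>\<one>\<close>, the relation
  solves for column \<open>i\<close> in terms of the others. The remaining \<open>c - 1\<close>
  columns, all in \<open>W\<close>, therefore determine the matrix.\<close>

lemma card_mats_with_cols_in_kernel_le:
  assumes W: "W \<subseteq> carrier (coord_space F r)"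
    and v: "v \<in> carrier (coord_space F c)" and i: "i < c" "v $ i = \<one>"
  shows "card {C \<in> mats_with_cols_in W r c. v \<in> matrix_ker F C} \<le> card W ^ (c - 1)"
proof -
  let ?K = "{C \<in> mats_with_cols_in W r c. v \<in> matrix_ker F C}"
  let ?I = "{..<c} - {i}"
  let ?cols = "\<lambda>C. restrict (col C) ?I"
  have v': "v $ k \<in> carrier F" if "k < c" for k
    using v that by (auto simp: coord_space_simps)
  have mem: "dim_row C = r" "dim_col C = c" "\<And>a k. a < r \<Longrightarrow> k < c \<Longrightarrow> C $$ (a, k) \<in> carrier F"
    if "C \<in> ?K" for C
    using that mats_with_cols_in_subset_mats[OF W, of c] by (auto simp: mats_def)
  have ker: "C $$ (a, i) \<oplus> (\<Oplus>k\<in>?I. C $$ (a, k) \<otimes> v $ k) = \<zero>"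
    if C: "C \<in> ?K" and a: "a < r" for C a
  proof -
    have "(\<Oplus>k\<in>insert i ?I. C $$ (a, k) \<otimes> v $ k) =
        C $$ (a, i) \<otimes> v $ i \<oplus> (\<Oplus>k\<in>?I. C $$ (a, k) \<otimes> v $ k)"
      using mem[OF C] v' a i by (intro finsum_insert) auto
    moreover have "insert i ?I = {..<c}" using i by auto
    moreover have "matrix_map F C v $ a = \<zero>"
      using C a mem[OF C] by (simp add: matrix_ker_def coord_space_simps)
    then have "(\<Oplus>k\<in>{..<c}. C $$ (a, k) \<otimes> v $ k) = \<zero>"
      using a mem[OF C] by (simp add: matrix_map_def)
    ultimately show ?thesis
      using i a mem[OF C] by simp
  qed
  have "card ?K \<le> card (?I \<rightarrow>\<^sub>E W)"
  proof (rule card_inj_on_le)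
    show "inj_on ?cols ?K"
    proof (rule inj_onI)
      fix C D assume C: "C \<in> ?K" and D: "D \<in> ?K" and eq: "?cols C = ?cols D"
      have other: "C $$ (a, k) = D $$ (a, k)" if "a < r" "k < c" "k \<noteq> i" for a k
      proof -
        have "col C k = col D k"
          using fun_cong[OF eq, of k] that by simp
        then have "col C k $ a = col D k $ a" by simp
        then show ?thesis
          using that mem[OF C] mem[OF D] by simp
      qed
      have same: "C $$ (a, i) = D $$ (a, i)" if a: "a < r" for a
      proof -
        \<comment> \<open>\<open>S\<close> is the contribution of the columns other than
          \<open>i\<close>; it is the same for \<open>C\<close> and \<open>D\<close>, so it cancels
          from the two relations.\<close>
        define S where "S = (\<Oplus>k\<in>?I. C $$ (a, k) \<otimes> v $ k)"
        have S: "S \<in> carrier F"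
          unfolding S_def using mem[OF C] v' a by (intro finsum_closed) auto
        have "S = (\<Oplus>k\<in>?I. D $$ (a, k) \<otimes> v $ k)"
          unfolding S_def using other a mem[OF D] v' by (intro finsum_cong') auto
        then have "C $$ (a, i) \<oplus> S = D $$ (a, i) \<oplus> S"
          using ker[OF C a] ker[OF D a] S_def by simp
        then show ?thesis
          using S a i mem[OF C] mem[OF D] by (simp add: add.right_cancel)
      qed
      show "C = D"
      proof (rule eq_matI)
        fix a k assume "a < dim_row D" "k < dim_col D"
        then show "C $$ (a, k) = D $$ (a, k)"
          using same other mem(1,2)[OF D] by (cases "k = i") simp_all
      qed (use mem(1,2)[OF C] mem(1,2)[OF D] in simp_all)
    qed
    show "?cols ` ?K \<subseteq> ?I \<rightarrow>\<^sub>E W"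
      by (auto simp: mats_with_cols_in_def split: if_splits)
    show "finite (?I \<rightarrow>\<^sub>E W)"
      using finite_subset[OF W finite_coord_space[OF finite_carrier]] by (intro finite_PiE) auto
  qed
  also have "\<dots> = card W ^ (c - 1)"
    using i by (simp add: card_PiE)
  finally show ?thesis .
qed

text \<open>All entries from position \<open>i\<close> on are prescribed, so the first
  \<open>i\<close> entries determine the vector. These are the possible witnesses delivered by
  \<open>matrix_map_kernel_witness\<close>.\<close>

lemma card_leading_one_le:
  assumes "i < c"
  shows "card {v \<in> carrier (coord_space F c). v $ i = \<one> \<and> (\<forall>j. i < j \<and> j < c \<longrightarrow> v $ j = \<zero>)}
    \<le> card (carrier F) ^ i" (is "card ?V \<le> _")
proof -
  have "card ?V \<le> card (carrier (coord_space F i))"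
  proof (rule card_inj_on_le)
    show "inj_on (\<lambda>v. vec i (($) v)) ?V"
    proof (rule inj_onI)
      fix u v assume u: "u \<in> ?V" and v: "v \<in> ?V" and eq: "vec i (($) u) = vec i (($) v)"
      show "u = v"
      proof (rule eq_vecI)
        fix j assume "j < dim_vec v"
        then have j: "j < c" using v by (auto simp: coord_space_simps)
        consider "j < i" | "j = i" | "i < j" by linarith
        then show "u $ j = v $ j"
        proof cases
          case 1
          then show ?thesis using arg_cong[OF eq, of "\<lambda>w. w $ j"] by simp
        qed (use u v j in auto)
      qed (use u v in \<open>auto simp: coord_space_simps\<close>)
    qed
    show "(\<lambda>v. vec i (($) v)) ` ?V \<subseteq> carrier (coord_space F i)"
      using assms by (auto simp: coord_space_simps)
    show "finite (carrier (coord_space F i))"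
      by (rule finite_coord_space[OF finite_carrier])
  qed
  then show ?thesis by (simp add: card_coord_space)
qed

text \<open>Union bound over the position \<open>i\<close> of the last nonzero coefficient and over
  the witnesses \<open>v\<close>. The estimate is multiplied out by the field size to stay within
  natural numbers.\<close>

lemma card_low_rank_le:
  assumes W: "submodule F W (coord_space F r)" and card_W: "card W = card (carrier F) ^ k"
  shows "card {C \<in> mats_with_cols_in W r c. matrix_rank F C < min k c} * card (carrier F)
    \<le> c * card W ^ c"
proof -
  let ?q = "card (carrier F)"
  define V where "V i = {v \<in> carrier (coord_space F c). v $ i = \<one> \<and> (\<forall>j. i < j \<and> j < c \<longrightarrow> v $ j = \<zero>)}" for i
  define K where "K v = {C \<in> mats_with_cols_in W r c. v \<in> matrix_ker F C}" for v
  let ?B = "{C \<in> mats_with_cols_in W r c. matrix_rank F C < min k c}"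
  have W_sub: "W \<subseteq> carrier (coord_space F r)"
    using W by (rule submodule.subset)
  have fin: "finite (mats_with_cols_in W r c)"
    using finite_subset[OF mats_with_cols_in_subset_mats[OF W_sub] finite_mats[OF finite_carrier]] .
  have finV: "finite (V i)" for i
    using finite_coord_space[OF finite_carrier, of c] by (simp add: V_def)
  have "?B \<subseteq> (\<Union>i<min k c. \<Union>v\<in>V i. K v)"
  proof
    fix C assume C: "C \<in> ?B"
    then have "C \<in> mats F r c"
      using mats_with_cols_in_subset_mats[OF W_sub] by blast
    then obtain i v where "i < min k c" "v \<in> carrier (coord_space F c)" "v $ i = \<one>"
      "\<And>j. i < j \<Longrightarrow> j < c \<Longrightarrow> v $ j = \<zero>" "v \<in> matrix_ker F C"
      by (rule matrix_map_kernel_witness[where s = "min k c"]) (use C in auto)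
    then have "i < min k c" "v \<in> V i" "v \<in> matrix_ker F C"
      by (simp_all add: V_def)
    then show "C \<in> (\<Union>i<min k c. \<Union>v\<in>V i. K v)"
      using C by (auto simp: K_def)
  qed
  then have "card ?B \<le> card (\<Union>i<min k c. \<Union>v\<in>V i. K v)"
    using fin finV by (intro card_mono) (auto simp: K_def)
  also have "\<dots> \<le> (\<Sum>i<min k c. card (\<Union>v\<in>V i. K v))"
    by (rule card_UN_le) simp
  also have "\<dots> \<le> (\<Sum>i<min k c. \<Sum>v\<in>V i. card (K v))"
    by (intro sum_mono card_UN_le finV)
  also have "\<dots> \<le> (\<Sum>i<min k c. \<Sum>v\<in>V i. card W ^ (c - 1))"
  proof (intro sum_mono)
    fix i v assume "i \<in> {..<min k c}" "v \<in> V i"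
    then show "card (K v) \<le> card W ^ (c - 1)"
      unfolding K_def V_def by (intro card_mats_with_cols_in_kernel_le[OF W_sub, of v c i]) auto
  qed
  also have "\<dots> = (\<Sum>i<min k c. card (V i) * card W ^ (c - 1))"
    by simp
  finally have "card ?B * ?q \<le> (\<Sum>i<min k c. card (V i) * card W ^ (c - 1)) * ?q"
    by (rule mult_le_mono1)
  also have "\<dots> = (\<Sum>i<min k c. card (V i) * card W ^ (c - 1) * ?q)"
    by (simp add: sum_distrib_right)
  also have "\<dots> \<le> (\<Sum>i<min k c. card W ^ c)"
  proof (rule sum_mono)
    fix i assume i: "i \<in> {..<min k c}"
    have "card (V i) * ?q \<le> ?q ^ i * ?q"
      unfolding V_def using i by (intro mult_le_mono1 card_leading_one_le) simp
    also have "\<dots> = ?q ^ Suc i" by simp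
    \<comment> \<open>Here \<open>i < k\<close> enters: \<open>Suc i\<close> is at most
      \<open>k\<close>, so the extra factor \<open>card (carrier F)\<close> still fits.\<close>
    also have "\<dots> \<le> card W"
      unfolding card_W using i card_carrier_gt_1 by (intro power_increasing) auto
    finally have "card (V i) * ?q * card W ^ (c - 1) \<le> card W * card W ^ (c - 1)"
      by (rule mult_le_mono1)
    \<comment> \<open>\<open>i < c\<close> makes \<open>c\<close> positive, so \<open>c - 1\<close>
      is a true predecessor.\<close>
    also have "\<dots> = card W ^ c"
      using i by (simp flip: power_Suc)
    finally show "card (V i) * card W ^ (c - 1) * ?q \<le> card W ^ c"
      by (simp add: mult_ac)
  qed
  also have "\<dots> \<le> c * card W ^ c"
    by simp
  finally show ?thesis .
qed

text \<open>The image lies in \<open>W\<close>, and rank-nullity bounds the rank by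
  \<open>c\<close>. Hence a rank different from \<open>min k c\<close> is strictly smaller, which is
  the case counted in \<open>card_low_rank_le\<close>.\<close>

lemma matrix_rank_le_of_cols_in:
  assumes W: "submodule F W (coord_space F r)" and card_W: "card W = card (carrier F) ^ k"
    and C: "C \<in> mats_with_cols_in W r c"
  shows "matrix_rank F C \<le> min k c"
proof -
  have W_sub: "W \<subseteq> carrier (coord_space F r)"
    using W by (rule submodule.subset)
  have C': "C \<in> mats F r c"
    using mats_with_cols_in_subset_mats[OF W_sub] C by blast
  have "matrix_im F C \<subseteq> W"
    using matrix_map_in_submodule[OF W C] C' by (auto simp: matrix_im_def mats_def)
  then have "card (matrix_im F C) \<le> card W"
    by (intro card_mono finite_subset[OF W_sub finite_coord_space[OF finite_carrier]])
  then have "matrix_rank F C \<le> k"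
    using card_carrier_gt_1 by (simp add: card_matrix_im[OF C'] card_W)
  moreover have "matrix_rank F C \<le> c"
    using matrix_rank_plus_nul[OF C'] by simp
  ultimately show ?thesis by simp
qed

section \<open>Proportion of admissible matrices of maximal rank\<close>

lemma admissible_next_eq:
  assumes "A \<in> mats F (target_dim n m) (n m)"
  shows "admissible_next F n m A = mats_with_cols_in (matrix_ker F A) (n m) (n (Suc m))"
proof -
  have "mats_with_cols_in (matrix_ker F A) (n m) (n (Suc m)) \<subseteq> mats F (n m) (n (Suc m))"
    by (rule mats_with_cols_in_subset_mats[OF matrix_ker_subset[OF assms]])
  moreover have "C \<in> mats_with_cols_in (matrix_ker F A) (n m) (n (Suc m)) \<longleftrightarrow>
      (\<forall>j<n (Suc m). col C j \<in> matrix_ker F A)" if "C \<in> mats F (n m) (n (Suc m))" for C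
    using that by (auto simp: mats_with_cols_in_def mats_def)
  ultimately show ?thesis
    using matrix_mult_eq_zero_iff[OF assms] by (auto simp: admissible_next_def)
qed

text \<open>The admissible matrices split into those of maximal and those of deficient rank, and the
  latter form a proportion of at most \<open>n (Suc m)\<close> over the field size.\<close>

lemma card_full_rank_ge:
  assumes A: "A \<in> mats F (target_dim n m) (n m)"
  shows "1 - real (n (Suc m)) / real (card (carrier F)) \<le>
    real (card {C \<in> admissible_next F n m A. matrix_rank F C = min (nul F A) (n (Suc m))}) /
    real (card (admissible_next F n m A))"
proof -
  let ?q = "card (carrier F)" and ?W = "matrix_ker F A" and ?c = "n (Suc m)"
  let ?S = "mats_with_cols_in ?W (n m) ?c"
  let ?G = "{C \<in> ?S. matrix_rank F C = min (nul F A) ?c}"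
  let ?B = "{C \<in> ?S. matrix_rank F C < min (nul F A) ?c}"
  note W = submodule_matrix_ker[OF A] and card_W = card_matrix_ker[OF A]
  have W_sub: "?W \<subseteq> carrier (coord_space F (n m))"
    by (rule matrix_ker_subset[OF A])
  have fin: "finite ?S"
    using finite_subset[OF mats_with_cols_in_subset_mats[OF W_sub] finite_mats[OF finite_carrier]] .
  have "?S = ?G \<union> ?B"
    using matrix_rank_le_of_cols_in[OF W card_W] by (auto simp: le_less)
  then have "card ?S = card (?G \<union> ?B)" by simp
  also have "\<dots> = card ?G + card ?B"
    using fin by (intro card_Un_disjoint) auto
  finally have S: "card ?S = card ?G + card ?B" .
  have "0 < ?q" using card_carrier_gt_1 by simp
  then have "0 < card ?W ^ ?c" by (simp add: card_W)
  also have le: "card ?W ^ ?c \<le> card ?S"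
    by (rule card_mats_with_cols_in_ge[OF finite_carrier W_sub])
  finally have pos: "0 < card ?S" .
  \<comment> \<open>The count of deficient matrices is bounded relative to
    \<open>card ?W ^ ?c\<close>, which \<open>le\<close> replaces by the number of all admissible
    matrices.\<close>
  have "card ?B * ?q \<le> ?c * card ?S"
    using card_low_rank_le[OF W card_W, of ?c] le by (meson le_trans mult_le_mono2)
  then have "real (card ?B * ?q) \<le> real (?c * card ?S)"
    by (rule of_nat_mono)
  then have "real (card ?B) * real ?q \<le> real ?c * real (card ?S)"
    by (simp only: of_nat_mult)
  moreover have "b / s \<le> c / q" if "0 < s" "0 < q" "b * q \<le> c * s" for b c q s :: real
    using that by (simp add: field_simps)
  ultimately have "real (card ?B) / real (card ?S) \<le> real ?c / real ?q"
    using pos \<open>0 < ?q\<close> by simp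
  moreover have "real (card ?G) = real (card ?S) - real (card ?B)"
    unfolding S by simp
  then have "real (card ?G) / real (card ?S) = 1 - real (card ?B) / real (card ?S)"
    using pos by (simp only: diff_divide_distrib) simp
  ultimately show ?thesis
    by (simp add: admissible_next_eq[OF A])
qed

text \<open>A zero target forces rank 0. This starts the recursion of nullities at the matrix with
  index 0.\<close>

lemma nul_zero_rows:
  assumes "A \<in> mats F 0 c"
  shows "nul F A = c"
  using matrix_rank_plus_nul[OF assms] matrix_rank_le_target_dim[OF assms] by simp

end

section \<open>Random chain complexes\<close>

locale finite_field_chain_complex = uniform_random_chain_complex M F n A + finite_field F
  for M :: "'w measure" and F :: "('a, 'b) ring_scheme" and n :: "nat \<Rightarrow> nat"
    and A :: "nat \<Rightarrow> 'w \<Rightarrow> 'a mat"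
begin

section \<open>Measurability of events\<close>

lemma random_matrix_in_mats: "\<omega> \<in> space M \<Longrightarrow> A m \<omega> \<in> mats F (target_dim n m) (n m)"
  using measurable_space[OF random_matrix] unfolding space_count_space .

lemma sets_Collect_random_matrix: "{\<omega> \<in> space M. P (A m \<omega>)} \<in> events"
proof -
  have "{\<omega> \<in> space M. P (A m \<omega>)} =
      A m -` {C \<in> mats F (target_dim n m) (n m). P C} \<inter> space M"
    using random_matrix_in_mats by auto
  also have "\<dots> \<in> events"
    by (rule measurable_sets[OF random_matrix]) auto
  finally show ?thesis .
qed

text \<open>Splitting over the finitely many values of \<open>A l\<close> reduces to events about
  one matrix. Rank conditions and Betti numbers compare two consecutive matrices.\<close>

lemma sets_Collect_random_matrix2: "{\<omega> \<in> space M. P (A l \<omega>) (A m \<omega>)} \<in> events"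
proof -
  have "{\<omega> \<in> space M. P (A l \<omega>) (A m \<omega>)} = (\<Union>C\<in>mats F (target_dim n l) (n l).
      {\<omega> \<in> space M. A l \<omega> = C} \<inter> {\<omega> \<in> space M. P C (A m \<omega>)})"
    using random_matrix_in_mats by auto
  also have "\<dots> \<in> events"
    using finite_mats[OF finite_carrier] sets_Collect_random_matrix
    by (intro sets.finite_UN sets.Int) auto
  finally show ?thesis .
qed

abbreviation history :: "nat \<Rightarrow> (nat \<Rightarrow> 'a mat) \<Rightarrow> 'w set" where
  "history m a \<equiv> {\<omega> \<in> space M. \<forall>i\<le>m. A i \<omega> = a i}"

lemma sets_history: "history m a \<in> events"
proof -
  have "{\<omega> \<in> space M. \<forall>i\<in>{..m}. A i \<omega> = a i} \<in> events"
    by (rule sets.sets_Collect_finite_All[OF sets_Collect_random_matrix]) simp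
  then show ?thesis by (simp only: atMost_iff Ball_def)
qed

text \<open>The rank attains the largest value compatible with the kernel of the preceding matrix
  and the number of columns.\<close>

definition full_rank :: "nat \<Rightarrow> 'w set" where
  "full_rank m =
    {\<omega> \<in> space M. matrix_rank F (A (Suc m) \<omega>) = min (nul F (A m \<omega>)) (n (Suc m))}"

lemma sets_full_rank: "full_rank m \<in> events"
  unfolding full_rank_def by (rule sets_Collect_random_matrix2)

section \<open>Probability of maximal rank\<close>

text \<open>Given the history, the next matrix is uniform on the admissible set, so the counting
  bound is a conditional probability bound. The product form also covers histories of probability
  0.\<close>

lemma prob_full_rank_history_ge:
  "(1 - real (n (Suc m)) / real (card (carrier F))) * prob (history m a) \<le>
    prob (full_rank m \<inter> history m a)"
proof (cases "prob (history m a) = 0")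
  case False
  then have pos: "prob (history m a) > 0"
    by (simp add: zero_less_measure_iff)
  \<comment> \<open>A sample point with this history shows that \<open>a m\<close> has the right
    size and entries.\<close>
  then have "history m a \<noteq> {}" by force
  then have am: "a m \<in> mats F (target_dim n m) (n m)"
    using random_matrix_in_mats[of _ m] by force
  let ?adm = "admissible_next F n m (a m)"
  define G where "G = {C \<in> ?adm. matrix_rank F C = min (nul F (a m)) (n (Suc m))}"
  define E where "E C = {\<omega> \<in> space M. A (Suc m) \<omega> = C \<and> (\<forall>i\<le>m. A i \<omega> = a i)}" for C
  have E_eq: "E C = {\<omega> \<in> space M. A (Suc m) \<omega> = C} \<inter> history m a" for C
    by (auto simp: E_def)
  have E_sets: "E C \<in> events" for C
    unfolding E_eq by (rule sets.Int[OF sets_Collect_random_matrix sets_history])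
  have "finite ?adm"
    using finite_mats[OF finite_carrier] by (simp add: admissible_next_def)
  then have finG: "finite G" by (simp add: G_def)
  have prob_E: "prob (E C) = 1 / real (card ?adm) * prob (history m a)" if "C \<in> G" for C
  proof -
    have "prob (E C) / prob (history m a) = 1 / real (card ?adm)"
      using uniform_next[OF pos, of C] that by (simp add: cond_prob_def E_def G_def)
    then show ?thesis
      using pos by (simp add: field_simps)
  qed
  have "(1 - real (n (Suc m)) / real (card (carrier F))) * prob (history m a) \<le>
      real (card G) / real (card ?adm) * prob (history m a)"
    unfolding G_def by (intro mult_right_mono card_full_rank_ge[OF am] measure_nonneg)
  also have "\<dots> = (\<Sum>C\<in>G. prob (E C))"
    by (simp add: prob_E)
  also have "\<dots> = prob (\<Union>C\<in>G. E C)"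
    using finG E_sets
    by (intro finite_measure_finite_Union[symmetric]) (auto simp: disjoint_family_on_def E_def)
  also have "\<dots> \<le> prob (full_rank m \<inter> history m a)"
    by (intro finite_measure_mono sets.Int sets_full_rank sets_history)
      (auto simp: E_def G_def full_rank_def)
  finally show ?thesis .
qed simp

text \<open>Law of total probability: the same bound holds on every history, and finitely many
  histories partition the space.\<close>

lemma prob_full_rank_ge: "1 - real (n (Suc m)) / real (card (carrier F)) \<le> prob (full_rank m)"
proof -
  let ?p = "1 - real (n (Suc m)) / real (card (carrier F))"
  \<comment> \<open>Extensional functions make the index unique: two elements of \<open>H\<close>
    agreeing up to \<open>m\<close> are equal, so each sample point has exactly one history.\<close>
  define H where "H = (\<Pi>\<^sub>E i\<in>{..m}. mats F (target_dim n i) (n i))"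
  have finH: "finite H"
    unfolding H_def by (intro finite_PiE finite_mats[OF finite_carrier]) auto
  have disj: "a = b" if "a \<in> H" "b \<in> H" "\<omega> \<in> history m a" "\<omega> \<in> history m b" for a b \<omega>
    using that unfolding H_def by (intro PiE_ext[of a "{..m}" _ b]) auto
  have cover: "\<exists>a\<in>H. \<omega> \<in> history m a" if "\<omega> \<in> space M" for \<omega>
    using that random_matrix_in_mats[OF that]
    by (intro bexI[of _ "restrict (\<lambda>i. A i \<omega>) {..m}"]) (auto simp: H_def)
  have total: "prob B = (\<Sum>a\<in>H. prob (B \<inter> history m a))" if B: "B \<in> events" for B
  proof -
    have "B = (\<Union>a\<in>H. B \<inter> history m a)"
      using cover sets.sets_into_space[OF B] by blast
    then have "prob B = prob (\<Union>a\<in>H. B \<inter> history m a)"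
      by (rule arg_cong)
    also have "prob (\<Union>a\<in>H. B \<inter> history m a) = (\<Sum>a\<in>H. prob (B \<inter> history m a))"
    proof (rule finite_measure_finite_Union[OF finH])
      show "(\<lambda>a. B \<inter> history m a) ` H \<subseteq> events"
        using B sets_history by blast
      show "disjoint_family_on (\<lambda>a. B \<inter> history m a) H"
        unfolding disjoint_family_on_def using disj by blast
    qed
    finally show ?thesis .
  qed
  have "?p = ?p * prob (space M)"
    by (simp add: prob_space)
  also have "\<dots> = (\<Sum>a\<in>H. ?p * prob (space M \<inter> history m a))"
    unfolding total[OF sets.top] by (rule sum_distrib_left)
  also have "\<dots> = (\<Sum>a\<in>H. ?p * prob (history m a))"
  proof -
    have "space M \<inter> history m a = history m a" for a by blast
    then show ?thesis by (simp only:)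
  qed
  also have "\<dots> \<le> (\<Sum>a\<in>H. prob (full_rank m \<inter> history m a))"
    by (intro sum_mono prob_full_rank_history_ge)
  also have "\<dots> = prob (full_rank m)"
    by (rule total[OF sets_full_rank, symmetric])
  finally show ?thesis .
qed

section \<open>Betti numbers under maximal rank\<close>

text \<open>By rank-nullity the next nullity is \<open>n (Suc m)\<close> minus the minimum of itself
  and the current nullity, that is, the positive part of their difference.\<close>

lemma nul_eq_nested_diff:
  assumes "\<omega> \<in> space M" "\<And>l. l < m \<Longrightarrow> \<omega> \<in> full_rank l"
  shows "int (nul F (A m \<omega>)) = nested_diff n m"
  using assms(2)
proof (induction m)
  case 0
  have "A 0 \<omega> \<in> mats F 0 (n 0)"
    using random_matrix_in_mats[OF assms(1), of 0] by (simp add: target_dim_def)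
  then show ?case by (simp add: nul_zero_rows)
next
  case (Suc m)
  have "int (nul F (A m \<omega>)) = nested_diff n m"
    by (rule Suc.IH) (simp add: Suc.prems)
  moreover have "matrix_rank F (A (Suc m) \<omega>) = min (nul F (A m \<omega>)) (n (Suc m))"
    using Suc.prems[of m] by (simp add: full_rank_def)
  moreover have "matrix_rank F (A (Suc m) \<omega>) + nul F (A (Suc m) \<omega>) = n (Suc m)"
    by (rule matrix_rank_plus_nul[OF random_matrix_in_mats[OF assms(1)]])
  ultimately show ?case by auto
qed

text \<open>Subtracting the minimum of nullity and \<open>n (Suc m)\<close> from the nullity leaves
  the positive part. Compared with the nullity alone, one further rank, at step \<open>m\<close>, is
  involved.\<close>

lemma betti_eq_expected_betti:
  assumes "\<omega> \<in> space M" "\<And>l. l \<le> m \<Longrightarrow> \<omega> \<in> full_rank l"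
  shows "betti F (\<lambda>i. A i \<omega>) m = expected_betti n m"
proof -
  have "int (nul F (A m \<omega>)) = nested_diff n m"
    by (rule nul_eq_nested_diff[OF assms(1)]) (simp add: assms(2))
  moreover have "matrix_rank F (A (Suc m) \<omega>) = min (nul F (A m \<omega>)) (n (Suc m))"
    using assms(2)[of m] by (simp add: full_rank_def)
  ultimately show ?thesis
    by (auto simp: betti_def expected_betti_def)
qed

text \<open>An unexpected Betti number requires some step up to \<open>m\<close> to miss maximal
  rank; the union bound adds the failure probabilities.\<close>

lemma prob_betti_eq_expected_betti_ge:
  "1 - (\<Sum>l\<le>m. real (n (Suc l))) / real (card (carrier F)) \<le>
    \<P>(\<omega> in M. betti F (\<lambda>i. A i \<omega>) m = expected_betti n m)"
proof -
  let ?B = "\<lambda>l. space M - full_rank l"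
  let ?E = "{\<omega> \<in> space M. betti F (\<lambda>i. A i \<omega>) m = expected_betti n m}"
  have E: "?E \<in> events"
    unfolding betti_def by (rule sets_Collect_random_matrix2)
  have "space M - ?E \<subseteq> (\<Union>l\<le>m. ?B l)"
    using betti_eq_expected_betti by blast
  then have "prob (space M - ?E) \<le> prob (\<Union>l\<le>m. ?B l)"
    using sets_full_rank by (intro finite_measure_mono) auto
  also have "\<dots> \<le> (\<Sum>l\<le>m. prob (?B l))"
    using sets_full_rank by (intro finite_measure_subadditive_finite) auto
  also have "\<dots> \<le> (\<Sum>l\<le>m. real (n (Suc l)) / real (card (carrier F)))"
  proof (rule sum_mono)
    fix l
    show "prob (?B l) \<le> real (n (Suc l)) / real (card (carrier F))"
      using prob_full_rank_ge[of l] prob_compl[OF sets_full_rank[of l]] by linarith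
  qed
  also have "\<dots> = (\<Sum>l\<le>m. real (n (Suc l))) / real (card (carrier F))"
    by (rule sum_divide_distrib[symmetric])
  finally show ?thesis
    using prob_compl[OF E] by linarith
qed

end

section \<open>Limit along the primes\<close>

lemma finite_field_residue_ring:
  assumes "prime q"
  shows "finite_field (residue_ring (int q))"
proof -
  interpret residues_prime q "residue_ring (int q)"
    using assms by (rule residues_prime.intro)
  show ?thesis
    by unfold_locales (simp add: residue_ring_def)
qed

theorem theorem2:
  fixes n :: "nat \<Rightarrow> nat"
    and M :: "nat \<Rightarrow> 'w measure"
    and A :: "nat \<Rightarrow> nat \<Rightarrow> 'w \<Rightarrow> int mat"
  assumes "\<And>q. prime q \<Longrightarrow>
      uniform_random_chain_complex (M q) (residue_ring (int q)) n (A q)"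
  shows "\<forall>m. ((\<lambda>q. \<P>(\<omega> in M q. betti (residue_ring (int q)) (\<lambda>i. A q i \<omega>) m = expected_betti n m))
      \<longlongrightarrow> 1) (inf at_top (principal {q. prime q}))"
proof
  fix m
  let ?P = "\<lambda>q. \<P>(\<omega> in M q. betti (residue_ring (int q)) (\<lambda>i. A q i \<omega>) m = expected_betti n m)"
  let ?S = "\<Sum>l\<le>m. real (n (Suc l))"
  let ?primes = "inf at_top (principal {q. prime q})"
  have bounds: "1 - ?S / real q \<le> ?P q" "?P q \<le> 1" if q: "prime q" for q
  proof -
    interpret finite_field_chain_complex "M q" "residue_ring (int q)" n "A q"
      by (rule finite_field_chain_complex.intro[OF assms[OF q] finite_field_residue_ring[OF q]])
    have "card (carrier (residue_ring (int q))) = q"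
      by (simp add: residue_ring_def)
    then show "1 - ?S / real q \<le> ?P q"
      using prob_betti_eq_expected_betti_ge[of m] by simp
    show "?P q \<le> 1" by simp
  qed
  \<comment> \<open>\<open>?S\<close> does not depend on \<open>q\<close>, so the lower bound tends
    to 1 along all naturals, hence along the finer filter of primes.\<close>
  have "((\<lambda>q. 1 - ?S / real q) \<longlongrightarrow> 1 - 0) at_top"
    by (intro tendsto_diff tendsto_const lim_const_over_n)
  then have lower: "((\<lambda>q. 1 - ?S / real q) \<longlongrightarrow> 1) ?primes"
    by (intro tendsto_mono[OF inf_le1]) simp
  show "(?P \<longlongrightarrow> 1) ?primes"
    \<comment> \<open>The bounds are known for prime \<open>q\<close> only, which the principal part
      of the filter provides.\<close>
    by (rule tendsto_sandwich[OF _ _ lower tendsto_const])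
      (auto simp: eventually_inf_principal bounds)
qed

end
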